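(* Let $\mathsf T$ and $\mathsf T'$ be universal dcq-TMs. Then there is a constant $c$ (depending only on $\mathsf T,\mathsf T'$) such that for every string $x\in\{0,1\}^*$ and all quantum states $\rho,\sigma$, $$\operatorname{K}_{\mathsf T}(\rho\mid x;\sigma)\le \operatorname{K}_{\mathsf T'}(\rho\mid x;\sigma)+c\quad\text{and}\quad \operatorname{K}_{\mathsf T'}(\rho\mid x;\sigma)\le \operatorname{K}_{\mathsf T}(\rho\mid x;\sigma)+c,$$ i.e. $\operatorname{K}_{\mathsf T}(\rho\mid x;\sigma)=\operatorname{K}_{\mathsf T'}(\rho\mid x;\sigma)+O(1)$. Here $\operatorname{K}$ is written for the (conditional) quantum Kolmogorov complexity.
   Context: A quantum state is an $n$-qubit density operator for some $n$. $D(\rho,\sigma)=\tfrac12\|\rho-\sigma\|_1$ is the trace distance. **dcq-TM.** A deterministic-control quantum Turing machine (dcq-TM) is a pair $(Q,\delta)$, where $Q$ is a finite set of control states containing two distinct states $q_s$ (starting) and $q_h$ (halting), and $\delta:Q\times A\to U\times \Delta\times A\times \Delta\times Q$ is the transition function, with $A=\{0,1,\Box\}$ the alphabet of a two-way infinite classical tape, $\Delta=\{L,N,R\}$ the head displacements, and $U=\{\mathbb 1,\mathsf H,\mathsf S,\pi/8,\mathsf{Sw},\textsf{c-Not}\}$ the gate set (identity, Hadamard, phase gate, $\pi/8$ gate, swap, controlled-not). The machine also has a two-way infinite quantum tape, each cell being a qubit. If $\delta(q,a)=(u,d,a',d',q')$, then in state $q$ with the classical head reading $a$, the machine applies gate $u$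 at the position of the quantum head (two-qubit gates act on the cell under the head and its right neighbour), moves the quantum head by $d$, writes $a'$, moves the classical head by $d'$, and passes to state $q'$. Each tape has an anchor cell with index $0$. On input $(x;\rho)$, with $x\in\{0,1\}^*$ and $\rho$ an $n$-qubit state, the machine starts in $q_s$ with both heads on the anchors; the classical tape contains $x\,\Box\,n$ ($n$ in binary) starting at cell $1$ and is blank elsewhere; quantum cells $1,\dots,n$ are in state $\rho$, all others in $|0\rangle\langle 0|$. When $q_h$ is reached, the classical output $y$ is the string between the anchor and the first blank to its right, $m$ is the number written between the first and second blanks to the right of the anchor, and the quantum output is the reduced state of quantum cells $1,\dots,m$. One writes $\mathsf T(x;\rho)=(y;\sigma)$ and $\mathsf T^{(Q)}(x;\rho)=\sigma$. The symbol $\epsilon$ denotes a quantum input/output of size zero. Natural numbers are input as strings via a fixed one-to-one effective encoding. Tuples of strings are encoded as $(x_1,\dots,x_r)=1^{|x_1|}0x_1\cdots 1^{|x_{r-1}|}0x_{r-1}x_r$. **Universal dcq-TM.** A dcq-TM $\mathsf U$ is universal (with the s-m-n property) if for every dcq-TM $\mathsf V$ there are a computable map $s:\{0,1\}^*\to\{0,1\}^*$ and a constant $c$ with $|s(p)|\le|p|+c$ and $\mathsf U((s(p),y);\rho)=\mathsf V((p,y);\rho)$ for all strings $p,y$ and quantum inputs $\rho$ (one side halts iff the other does, with the same output). **Conditional complexity.** For a dcq-TM $\mathsf T$, a string $x$ and states $\rho,\sigma$, $$\operatorname{K}_{\mathsf T}(\rho\mid x;\sigma)=\inf\{|p|:\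 \forall k\ge1,\ D(\mathsf T^{(Q)}((p,x,k);\sigma),\rho)\le 1/k\},$$ where the condition includes that the machine halts with a quantum output on the same number of qubits as $\rho$, and $\inf\emptyset=\infty$. *)

theory Defs
  imports
    "HOL-Library.Extended_Nat"
    "HOL-Analysis.Infinite_Sum"
    "Jordan_Normal_Form.Schur_Decomposition"
begin

type_synonym bitstring = "bool list"

definition psd_mat :: "complex mat \<Rightarrow> bool" where
  "psd_mat A \<longleftrightarrow> square_mat A \<and> mat_adjoint A = A \<and>
     (\<forall>v \<in> carrier_vec (dim_row A). 0 \<le> Re ((A *\<^sub>v v) \<bullet>c v))"

definition qubit_state :: "nat \<Rightarrow> complex mat \<Rightarrow> bool" where
  "qubit_state n \<rho> \<longleftrightarrow> \<rho> \<in> carrier_mat (2 ^ n) (2 ^ n) \<and> psd_mat \<rho> \<and> (\<Sum>i<2 ^ n. \<rho> $$ (i, i)) = 1"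

definition quantum_state :: "complex mat \<Rightarrow> bool" where
  "quantum_state \<rho> \<longleftrightarrow> (\<exists>n. qubit_state n \<rho>)"

definition num_qubits :: "complex mat \<Rightarrow> nat" where
  "num_qubits \<rho> = (THE n. dim_row \<rho> = 2 ^ n)"

lemma num_qubits_eq: "qubit_state n \<rho> \<Longrightarrow> num_qubits \<rho> = n"
  by (auto simp: qubit_state_def num_qubits_def)

definition empty_state :: "complex mat" where
  "empty_state = 1\<^sub>m 1"

(* The Schatten 1-norm: the sum of the singular values of A, i.e. of the square roots of the
   eigenvalues of A^* A, counted with multiplicity. *)
definition trace_norm :: "complex mat \<Rightarrow> real" where
  "trace_norm A = (let B = mat_adjoint A * A in
     \<Sum>e | eigenvalue B e. real (order e (char_poly B)) * sqrt (Re e))"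

definition trace_distance :: "complex mat \<Rightarrow> complex mat \<Rightarrow> real" where
  "trace_distance \<rho> \<sigma> = trace_norm (\<rho> - \<sigma>) / 2"

type_synonym basis_state = "int \<Rightarrow> bool"

(* A state of the quantum tape is given by its matrix entries in the computational basis. Since all
   but finitely many cells are in state |0>, only entries at finitely supported basis states can be
   nonzero, and only finitely many of them. *)
type_synonym qtape = "basis_state \<Rightarrow> basis_state \<Rightarrow> complex"

(* Cells h, ..., h+a-1 hold a number below 2^a with the leftmost cell most significant; this is the
   usual ordering of the basis of an a-fold tensor product. *)
definition window_get :: "int \<Rightarrow> nat \<Rightarrow> basis_state \<Rightarrow> nat" where
  "window_get h a b = (\<Sum>i<a. of_bool (b (h + int i)) * 2 ^ (a - 1 - i))"

definition window_set :: "int \<Rightarrow> nat \<Rightarrow> nat \<Rightarrow> basis_state \<Rightarrow> basis_state" where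
  "window_set h a k b =
     (\<lambda>i. if h \<le> i \<and> i < h + int a then bit k (nat (h + int a - 1 - i)) else b i)"

definition init_qtape :: "nat \<Rightarrow> complex mat \<Rightarrow> qtape" where
  "init_qtape n \<rho> b b' =
     (if \<forall>i. b i \<or> b' i \<longrightarrow> 1 \<le> i \<and> i \<le> int n
      then \<rho> $$ (window_get 1 n b, window_get 1 n b') else 0)"

definition reduced_state :: "nat \<Rightarrow> qtape \<Rightarrow> complex mat" where
  "reduced_state m \<rho> = mat (2 ^ m) (2 ^ m) (\<lambda>(k, l).
     \<Sum>\<^sub>\<infinity>e\<in>{e. \<forall>i. e i \<longrightarrow> i < 1 \<or> int m < i}. \<rho> (window_set 1 m k e) (window_set 1 m l e))"

datatype gate = Id_Gate | Hadamard | Phase | Pi_8 | Swap | CNot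

definition gate_arity :: "gate \<Rightarrow> nat" where
  "gate_arity u = (if u = Swap \<or> u = CNot then 2 else 1)"

fun gate_mat :: "gate \<Rightarrow> complex mat" where
  "gate_mat Id_Gate = 1\<^sub>m 2"
| "gate_mat Hadamard = complex_of_real (1 / sqrt 2) \<cdot>\<^sub>m mat_of_rows_list 2 [[1, 1], [1, -1]]"
| "gate_mat Phase = mat_of_rows_list 2 [[1, 0], [0, \<i>]]"
| "gate_mat Pi_8 = mat_of_rows_list 2 [[1, 0], [0, cis (pi / 4)]]"
| "gate_mat Swap = mat_of_rows_list 4 [[1, 0, 0, 0], [0, 0, 1, 0], [0, 1, 0, 0], [0, 0, 0, 1]]"
| "gate_mat CNot = mat_of_rows_list 4 [[1, 0, 0, 0], [0, 1, 0, 0], [0, 0, 0, 1], [0, 0, 1, 0]]"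

(* The conjugation of the tape state by the gate, acting on the cells from h on and tensored with
   the identity elsewhere. *)
definition apply_gate :: "gate \<Rightarrow> int \<Rightarrow> qtape \<Rightarrow> qtape" where
  "apply_gate u h \<rho> b b' = (let a = gate_arity u; U = gate_mat u in
     \<Sum>k<2 ^ a. \<Sum>l<2 ^ a.
       U $$ (window_get h a b, k) * \<rho> (window_set h a k b) (window_set h a l b')
         * cnj (U $$ (window_get h a b', l)))"

(* None is the blank. *)
type_synonym symbol = "bool option"

datatype displacement = L | N | R

fun shift :: "displacement \<Rightarrow> int" where
  "shift L = -1"
| "shift N = 0"
| "shift R = 1"

(* Control states are natural numbers, which is no restriction for a finite set of states and lets
   one quantify over all machines. The values of trans outside states are irrelevant. *)
record dcq_tm =
  states :: "nat set"
  start_state :: nat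
  halt_state :: nat
  trans :: "nat \<Rightarrow> symbol \<Rightarrow> gate \<times> displacement \<times> symbol \<times> displacement \<times> nat"

definition is_dcq_tm :: "dcq_tm \<Rightarrow> bool" where
  "is_dcq_tm M \<longleftrightarrow> finite (states M) \<and> start_state M \<in> states M \<and> halt_state M \<in> states M \<and>
     start_state M \<noteq> halt_state M \<and>
     (\<forall>q \<in> states M. \<forall>a u d a' d' q'. trans M q a = (u, d, a', d', q') \<longrightarrow> q' \<in> states M)"

record config =
  cstate :: nat
  ctape :: "int \<Rightarrow> symbol"
  chead :: int
  qtape :: qtape
  qhead :: int

definition step :: "dcq_tm \<Rightarrow> config \<Rightarrow> config" where
  "step M c = (case trans M (cstate c) (ctape c (chead c)) of (u, d, a', d', q') \<Rightarrow>
     \<lparr>cstate = q',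
      ctape = (ctape c)(chead c := a'),
      chead = chead c + shift d',
      qtape = apply_gate u (qhead c) (qtape c),
      qhead = qhead c + shift d\<rparr>)"

(* Binary numeral, most significant bit first, without leading zeros; 0 is written as the single
   digit 0. *)
fun binary :: "nat \<Rightarrow> bitstring" where
  "binary n = (if n < 2 then [n = 1] else binary (n div 2) @ [odd n])"

declare binary.simps [simp del]

definition binary_value :: "bitstring \<Rightarrow> nat" where
  "binary_value w = foldl (\<lambda>m b. 2 * m + of_bool b) 0 w"

definition init_ctape :: "bitstring \<Rightarrow> nat \<Rightarrow> int \<Rightarrow> symbol" where
  "init_ctape x n i = (let w = map Some x @ [None] @ map Some (binary n) in
     if 1 \<le> i \<and> i \<le> int (length w) then w ! nat (i - 1) else None)"

definition init_config :: "dcq_tm \<Rightarrow> bitstring \<Rightarrow> complex mat \<Rightarrow> config" where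
  "init_config M x \<rho> =
     \<lparr>cstate = start_state M, ctape = init_ctape x (num_qubits \<rho>), chead = 0,
      qtape = init_qtape (num_qubits \<rho>) \<rho>, qhead = 0\<rparr>"

(* The string from cell i up to the next blank. *)
definition read_block :: "(int \<Rightarrow> symbol) \<Rightarrow> int \<Rightarrow> bitstring" where
  "read_block t i = map (\<lambda>d. the (t (i + int d))) [0..<(LEAST d. t (i + int d) = None)]"

definition output_of :: "config \<Rightarrow> bitstring \<times> complex mat" where
  "output_of c = (let y = read_block (ctape c) 1;
                      m = binary_value (read_block (ctape c) (int (length y) + 2))
                  in (y, reduced_state m (qtape c)))"

(* None if the machine does not halt. *)
definition run :: "dcq_tm \<Rightarrow> bitstring \<Rightarrow> complex mat \<Rightarrow> (bitstring \<times> complex mat) option" where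
  "run M x \<rho> = (let C = (\<lambda>t. (step M ^^ t) (init_config M x \<rho>)) in
     if \<exists>t. cstate (C t) = halt_state M
     then Some (output_of (C (LEAST t. cstate (C t) = halt_state M)))
     else None)"

(* The encoding of (p, x, k) is that of the pair (p, (x, k)). *)
fun tuple :: "bitstring list \<Rightarrow> bitstring" where
  "tuple [] = []"
| "tuple [x] = x"
| "tuple (x # y # ys) = replicate (length x) True @ [False] @ x @ tuple (y # ys)"

(* Computability by a deterministic Turing machine over the alphabet 0, 1, blank: a machine that
   applies no gate other than the identity is a classical one-tape Turing machine. *)
definition computable_map :: "(bitstring \<Rightarrow> bitstring) \<Rightarrow> bool" where
  "computable_map f \<longleftrightarrow> (\<exists>M. is_dcq_tm M \<and>
     (\<forall>q \<in> states M. \<forall>a. fst (trans M q a) = Id_Gate) \<and>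
     (\<forall>x. \<exists>\<sigma>. run M x empty_state = Some (f x, \<sigma>)))"

definition universal :: "dcq_tm \<Rightarrow> bool" where
  "universal U \<longleftrightarrow> is_dcq_tm U \<and>
     (\<forall>V. is_dcq_tm V \<longrightarrow> (\<exists>s c. computable_map s \<and>
        (\<forall>p. length (s p) \<le> length p + c) \<and>
        (\<forall>p y \<rho>. quantum_state \<rho> \<longrightarrow> run U (tuple [s p, y]) \<rho> = run V (tuple [p, y]) \<rho>)))"

(* Binary numerals serve as the fixed encoding of the natural number k as a string. *)
definition computes_approx ::
    "dcq_tm \<Rightarrow> bitstring \<Rightarrow> bitstring \<Rightarrow> complex mat \<Rightarrow> complex mat \<Rightarrow> bool" where
  "computes_approx T p x \<sigma> \<rho> \<longleftrightarrow> (\<forall>k\<ge>1. \<exists>y \<tau>.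
     run T (tuple [p, x, binary k]) \<sigma> = Some (y, \<tau>) \<and>
     dim_row \<tau> = dim_row \<rho> \<and> trace_distance \<tau> \<rho> \<le> 1 / real k)"

definition K :: "dcq_tm \<Rightarrow> complex mat \<Rightarrow> bitstring \<Rightarrow> complex mat \<Rightarrow> enat" where
  "K T \<rho> x \<sigma> = (INF p \<in> {p. computes_approx T p x \<sigma> \<rho>}. enat (length p))"

end

(* A program p for one universal machine becomes the program s(p) for the other. Since (p, x, k) is
   encoded as the pair (p, (x, k)), the s-m-n property applies with y = (x, k) for all k at once. *)
theory Submission
  imports Defs
begin

text \<open>A universal machine is optimal, up to a constant, among all dcq-TMs. The theorem uses
  this twice, with the two machines exchanged. The constant is uniform in \<open>x\<close>, \<rho>
  and \<sigma> because the s-m-n property supplies it from \<open>U\<close> and \<open>V\<close>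
  alone.\<close>

lemma universal_K_le:
  assumes "universal U" and "is_dcq_tm V"
  obtains c :: nat where
    "\<And>x \<rho> \<sigma>. quantum_state \<sigma> \<Longrightarrow> K U \<rho> x \<sigma> \<le> K V \<rho> x \<sigma> + enat c"
proof -
  obtain s c where len: "\<And>p. length (s p) \<le> length p + c"
    and sim: "\<And>p y \<sigma>. quantum_state \<sigma> \<Longrightarrow> run U (tuple [s p, y]) \<sigma> = run V (tuple [p, y]) \<sigma>"
    using assms unfolding universal_def by blast
  have "K U \<rho> x \<sigma> \<le> K V \<rho> x \<sigma> + enat c" if \<sigma>: "quantum_state \<sigma>" for x \<rho> \<sigma>
  proof (cases "{p. computes_approx V p x \<sigma> \<rho>} = {}")
    case True
    \<comment> \<open>With no program for \<open>V\<close>, the right-hand side is an infimum over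
      the empty set, hence \<infinity>.\<close>
    then show ?thesis
      by (simp add: K_def top_enat_def)
  next
    case False
    \<comment> \<open>A nonempty set of extended naturals has a least element, so the infimum is
      attained by a shortest program \<open>p\<close>.\<close>
    then have "K V \<rho> x \<sigma> \<in> (\<lambda>p. enat (length p)) ` {p. computes_approx V p x \<sigma> \<rho>}"
      unfolding K_def Inf_enat_def by (auto intro: LeastI)
    then obtain p where p: "computes_approx V p x \<sigma> \<rho>" and K_eq: "K V \<rho> x \<sigma> = enat (length p)"
      by auto
    \<comment> \<open>Both encodings of the triple unfold to the same string; \<open>w\<close> will
      be \<open>binary k\<close>.\<close>
    have "run U (tuple [s p, x, w]) \<sigma> = run V (tuple [p, x, w]) \<sigma>" for w
      using sim[OF \<sigma>, of p "tuple [x, w]"] by simp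
    \<comment> \<open>The runs agree for every accuracy \<open>k\<close>, so halting, output size
      and error bound all carry over from \<open>p\<close> to \<open>s p\<close>.\<close>
    with p have "computes_approx U (s p) x \<sigma> \<rho>"
      by (simp add: computes_approx_def)
    then have "K U \<rho> x \<sigma> \<le> enat (length (s p))"
      unfolding K_def by (intro INF_lower) simp
    also have "\<dots> \<le> K V \<rho> x \<sigma> + enat c"
      using len by (simp add: K_eq)
    finally show ?thesis .
  qed
  then show thesis
    by (rule that)
qed

theorem mainTheorem2:
  fixes T T' :: dcq_tm
  assumes "universal T" and "universal T'"
  shows "\<exists>c::nat. \<forall>(x::bitstring) \<rho> \<sigma>. quantum_state \<rho> \<longrightarrow> quantum_state \<sigma> \<longrightarrow>
           K T \<rho> x \<sigma> \<le> K T' \<rho> x \<sigma> + enat c \<and> K T' \<rho> x \<sigma> \<le> K T \<rho> x \<sigma> + enat c"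
proof -
  have machines: "is_dcq_tm T" "is_dcq_tm T'"
    using assms by (simp_all add: universal_def)
  obtain c where c: "\<And>x \<rho> \<sigma>. quantum_state \<sigma> \<Longrightarrow> K T \<rho> x \<sigma> \<le> K T' \<rho> x \<sigma> + enat c"
    using universal_K_le[OF assms(1) machines(2)] by blast
  obtain c' where c': "\<And>x \<rho> \<sigma>. quantum_state \<sigma> \<Longrightarrow> K T' \<rho> x \<sigma> \<le> K T \<rho> x \<sigma> + enat c'"
    using universal_K_le[OF assms(2) machines(1)] by blast
  \<comment> \<open>The maximum of the two one-sided constants serves both directions.\<close>
  have "K T \<rho> x \<sigma> \<le> K T' \<rho> x \<sigma> + enat (max c c') \<and> K T' \<rho> x \<sigma> \<le> K T \<rho> x \<sigma> + enat (max c c')"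
    if "quantum_state \<sigma>" for x \<rho> \<sigma>
    using c[OF that] c'[OF that]
    by (meson add_left_mono enat_ord_simps(1) max.cobounded1 max.cobounded2 order_trans)
  then show ?thesis
    by blast
qed

end
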